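(* Let $n\ge1$, $1<p<\infty$, $1<q\le\infty$ and $0<\gamma<1$, and let $w$ be a weight on $\mathbb{R}^{n+1}$. Then $w$ belongs to $RH^+_q$ if and only if there exists a constant $C$ such that $$\biggl(\frac1{|R^-(\gamma)|}\int_{R^-(\gamma)}w^q\,dx\,dt\biggr)^{1/q}\le C\,\frac1{|R^+(\gamma)|}\int_{R^+(\gamma)}w\,dx\,dt$$ for every parabolic rectangle $R\subset\mathbb{R}^{n+1}$ (where for $q=\infty$ the left-hand side is $\operatorname{ess\,sup}_{R^-(\gamma)}w$).
   Context: Points of $\mathbb{R}^{n+1}$ are written $(x,t)$ with $x\in\mathbb{R}^n$, $t\in\mathbb{R}$. For $x\in\mathbb{R}^n$, $t\in\mathbb{R}$, $L>0$ let $Q(x,L)=\{y\in\mathbb{R}^n:|y_i-x_i|\le L/2,\ i=1,\dots,n\}$. A parabolic rectangle is a set $R=R(x,t,L)=Q(x,L)\times(t-L^p,t+L^p)$. For $0\le\gamma<1$ put $$R^+(\gamma)=Q(x,L)\times(t+\gamma L^p,t+L^p),\qquad R^-(\gamma)=Q(x,L)\times(t-L^p,t-\gamma L^p),$$ and $R^\pm=R^\pm(0)$. A weight is a locally integrable nonnegative function on $\mathbb{R}^{n+1}$; $|A|$ is Lebesgue measure. For $1<q<\infty$, $w\in RH^+_q$ means there is a constant $C$ with $\bigl(\frac1{|R^-|}\int_{R^-}w^q\bigr)^{1/q}\le C\frac1{|R^+|}\int_{R^+}w$ for every parabolic rectangle $R$. $w\in RH^+_\infty$ means there is a constant $C$ with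 $\operatorname{ess\,sup}_{R^-}w\le C\frac1{|R^+|}\int_{R^+}w$ for every parabolic rectangle $R$. *)

theory Defs
  imports "HOL-Analysis.Analysis" "HOL-Probability.Essential_Supremum"
begin

definition weight :: "('a::euclidean_space \<Rightarrow> real) \<Rightarrow> bool" where
  "weight w \<longleftrightarrow> (\<forall>z. 0 \<le> w z) \<and> (\<forall>K. compact K \<longrightarrow> w absolutely_integrable_on K)"

definition cube :: "real ^ 'n \<Rightarrow> real \<Rightarrow> (real ^ 'n) set" where
  "cube x L = {y. \<forall>i. \<bar>y $ i - x $ i\<bar> \<le> L / 2}"

text \<open>
  A parabolic rectangle \<open>R(x,t,L) = cube x L \<times> {t - L powr p <..< t + L powr p}\<close>, with \<open>L > 0\<close>,
  is given by its parameters \<open>x\<close>, \<open>t\<close>, \<open>L\<close>, so a statement about every parabolic rectangle is a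
  statement about all \<open>x\<close>, \<open>t\<close> and all \<open>L > 0\<close>.
\<close>

definition upper_part :: "real \<Rightarrow> real \<Rightarrow> real ^ 'n \<Rightarrow> real \<Rightarrow> real \<Rightarrow> ((real ^ 'n) \<times> real) set" where
  "upper_part p \<gamma> x t L = cube x L \<times> {t + \<gamma> * L powr p <..< t + L powr p}"

definition lower_part :: "real \<Rightarrow> real \<Rightarrow> real ^ 'n \<Rightarrow> real \<Rightarrow> real \<Rightarrow> ((real ^ 'n) \<times> real) set" where
  "lower_part p \<gamma> x t L = cube x L \<times> {t - L powr p <..< t - \<gamma> * L powr p}"

text \<open>Averages take values in \<^typ>\<open>ennreal\<close>, so that a non-integrable power has average \<open>\<infinity>\<close> and not 0.\<close>

definition average :: "('a::euclidean_space) set \<Rightarrow> ('a \<Rightarrow> real) \<Rightarrow> ennreal" where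
  "average A f = (\<integral>\<^sup>+ z \<in> A. ennreal (f z) \<partial>lebesgue) / emeasure lebesgue A"

text \<open>Real powers on \<^typ>\<open>ennreal\<close>; only used for positive exponents, hence the value at \<open>\<infinity>\<close>.\<close>

definition ennreal_powr :: "ennreal \<Rightarrow> real \<Rightarrow> ennreal" where
  "ennreal_powr a r = (if a = \<infinity> then \<infinity> else ennreal (enn2real a powr r))"

definition q_average :: "ennreal \<Rightarrow> ('a::euclidean_space) set \<Rightarrow> ('a \<Rightarrow> real) \<Rightarrow> ennreal" where
  "q_average q A w =
     (if q = \<infinity> then esssup (restrict_space lebesgue A) (\<lambda>z. ennreal (w z))
      else ennreal_powr (average A (\<lambda>z. w z powr enn2real q)) (1 / enn2real q))"

definition RH_plus :: "real \<Rightarrow> ennreal \<Rightarrow> ((real ^ 'n) \<times> real \<Rightarrow> real) set" where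
  "RH_plus p q = {w. \<exists>C::real. 0 \<le> C \<and> (\<forall>x t L. 0 < L \<longrightarrow>
     q_average q (lower_part p 0 x t L) w \<le> ennreal C * average (upper_part p 0 x t L) w)}"

end

theory Submission
  imports Defs
begin

text \<open>
  The gap \<open>\<gamma>\<close> can be replaced by any other value in \<open>[0,1)\<close>, so both implications are instances of
  one argument. Suppose the estimate holds with gap \<open>\<gamma>\<^sub>1\<close> and consider a rectangle of side \<open>L\<close>. Its
  lower part with gap \<open>\<gamma>\<^sub>2\<close> is covered by lower parts \<open>S\<close>, with gap \<open>\<gamma>\<^sub>1\<close>, of rectangles of side
  \<open>l = L / N\<close>; their number does not depend on \<open>L\<close>. The corresponding upper part is the translate of \<open>S\<close>
  by \<open>(1 + \<gamma>\<^sub>1) l\<^sup>p\<close> in time. As the average is at most the \<open>q\<close>-average, the hypothesis can be iterated: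
  it bounds the \<open>q\<close>-average over \<open>S\<close> by a constant times the average over the \<open>k\<close>-th translate. If \<open>N\<close> is
  large, then after a bounded number of steps the translate lies in the upper part of the given rectangle
  with gap \<open>\<gamma>\<^sub>2\<close>, and the two sets have comparable measure.
\<close>

section \<open>Measurability of weights\<close>

lemma weight_nonneg: "weight w \<Longrightarrow> 0 \<le> w z"
  by (simp add: weight_def)

text \<open>Integrability is given on compact sets only, so \<open>w\<close> is obtained as the
  pointwise limit of its truncations to balls; at each point these are eventually constant.\<close>

lemma weight_measurable:
  fixes w :: "'a::euclidean_space \<Rightarrow> real"
  assumes "weight w"
  shows "w \<in> borel_measurable lebesgue"
proof (rule borel_measurable_LIMSEQ_real)
  fix k :: nat
  have "w absolutely_integrable_on cball 0 (real k)"
    using assms by (simp add: weight_def)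
  then show "(\<lambda>z. indicator (cball 0 (real k)) z * w z) \<in> borel_measurable lebesgue"
    by (auto simp: set_integrable_def dest: borel_measurable_integrable)
next
  fix z :: 'a
  obtain K :: nat where K: "norm z \<le> real K"
    using real_arch_simple by blast
  have "\<forall>\<^sub>F k in sequentially. indicator (cball 0 (real k)) z * w z = w z"
    using eventually_ge_at_top[of K] by eventually_elim (use K in \<open>auto simp: indicator_def\<close>)
  then show "(\<lambda>k. indicator (cball 0 (real k)) z * w z) \<longlonglongrightarrow> w z"
    by (rule tendsto_eventually)
qed

section \<open>Power means and comparison of the average with the \<open>q\<close>-average\<close>

lemma one_less_enn2real:
  assumes "1 < q" "q \<noteq> \<infinity>"
  shows "1 < enn2real q"
  using assms by (cases q) (auto simp: ennreal_less_iff simp flip: ennreal_1)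

lemma q_average_finite:
  assumes "q \<noteq> \<infinity>"
  shows "q_average q A w = ennreal_powr (average A (\<lambda>z. w z powr enn2real q)) (1 / enn2real q)"
  using assms by (simp add: q_average_def)

text \<open>Lets the root in the \<open>q\<close>-average be moved to the other side of an estimate.
  For \<open>a = \<infinity>\<close> both sides are false.\<close>

lemma ennreal_powr_le_iff:
  assumes "0 < r" "0 \<le> m"
  shows "ennreal_powr a (1 / r) \<le> ennreal m \<longleftrightarrow> a \<le> ennreal (m powr r)"
proof (cases a)
  case (real x)
  have "x powr (1 / r) \<le> m \<longleftrightarrow> x \<le> m powr r"
  proof
    assume "x powr (1 / r) \<le> m"
    then have "(x powr (1 / r)) powr r \<le> m powr r"
      using assms by (intro powr_mono2) auto
    then show "x \<le> m powr r"
      using assms real by (simp add: powr_powr)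
  next
    assume "x \<le> m powr r"
    then have "x powr (1 / r) \<le> (m powr r) powr (1 / r)"
      using assms real by (intro powr_mono2) auto
    then show "x powr (1 / r) \<le> m"
      using assms by (simp add: powr_powr)
  qed
  then show ?thesis
    using real assms by (simp add: ennreal_powr_def)
qed (use assms in \<open>simp add: ennreal_powr_def top_unique\<close>)

text \<open>The right-hand side is affine in \<open>x powr r\<close> and equals \<open>m\<close> at \<open>x = m\<close>, so averaging it gives
  the power mean inequality.\<close>

lemma Young_affine:
  fixes x m r :: real
  assumes "1 < r" "0 \<le> x" "0 < m"
  shows "x \<le> m / (r * m powr r) * x powr r + m * (1 - 1 / r)"
proof -
  \<comment> \<open>Young's inequality for \<open>x / m\<close> and 1 with the conjugate exponents
    \<open>r\<close> and \<open>r / (r - 1)\<close>; the factor 1 produces the constant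
    \<open>1 - 1 / r\<close>.\<close>
  have "x / m * 1 \<le> (x / m) powr r / r + 1 powr (r / (r - 1)) / (r / (r - 1))"
    using assms by (intro Youngs_inequality) (auto simp: field_simps)
  also have "\<dots> = (x / m) powr r / r + (1 - 1 / r)"
    using assms by (simp add: field_simps)
  finally have "m * (x / m) \<le> m * ((x / m) powr r / r + (1 - 1 / r))"
    using assms by (intro mult_left_mono) auto
  then show ?thesis
    using assms by (simp add: powr_divide algebra_simps)
qed

lemma average_le_iff:
  assumes "0 < emeasure lebesgue A" "emeasure lebesgue A < \<infinity>"
  shows "average A f \<le> B \<longleftrightarrow> (\<integral>\<^sup>+ z \<in> A. ennreal (f z) \<partial>lebesgue) \<le> emeasure lebesgue A * B"
proof
  assume "average A f \<le> B"
  then have "average A f * emeasure lebesgue A \<le> B * emeasure lebesgue A"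
    by (rule mult_right_mono) simp
  moreover have "average A f * emeasure lebesgue A = (\<integral>\<^sup>+ z \<in> A. ennreal (f z) \<partial>lebesgue)"
    using assms unfolding average_def by (simp add: ennreal_divide_times del: emeasure_completion)
  ultimately show "(\<integral>\<^sup>+ z \<in> A. ennreal (f z) \<partial>lebesgue) \<le> emeasure lebesgue A * B"
    by (simp only: mult.commute)
qed (use assms in \<open>simp add: average_def divide_le_posI_ennreal\<close>)

text \<open>Integrates \<open>Young_affine\<close> over \<open>A\<close>. The level \<open>m\<close>
  is kept as a parameter, so no root of the average has to be taken; it must be positive because the
  slope contains \<open>1 / m powr r\<close>.\<close>

lemma average_le_of_powr:
  fixes w :: "'a::euclidean_space \<Rightarrow> real"
  assumes A: "A \<in> sets lebesgue" "0 < emeasure lebesgue A" "emeasure lebesgue A < \<infinity>"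
    and w [measurable]: "w \<in> borel_measurable lebesgue" and nonneg: "\<And>z. 0 \<le> w z"
    and "1 < r" "0 < m"
    and le: "average A (\<lambda>z. w z powr r) \<le> ennreal (m powr r)"
  shows "average A w \<le> ennreal m"
proof -
  note [measurable] = A(1)
  define c where "c = m / (r * m powr r)"
  define d where "d = m * (1 - 1 / r)"
  have cd: "0 \<le> c" "0 \<le> d"
    using assms by (auto simp: c_def d_def)
  have "(\<integral>\<^sup>+ z \<in> A. ennreal (w z) \<partial>lebesgue) \<le>
      (\<integral>\<^sup>+ z. ennreal c * (ennreal (w z powr r) * indicator A z) + ennreal d * indicator A z \<partial>lebesgue)"
  proof (rule nn_integral_mono)
    fix z
    have "ennreal (w z) \<le> ennreal (c * w z powr r + d)"
      unfolding c_def d_def using assms by (intro ennreal_leI Young_affine) auto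
    then show "ennreal (w z) * indicator A z \<le>
        ennreal c * (ennreal (w z powr r) * indicator A z) + ennreal d * indicator A z"
      using cd by (auto simp: indicator_def ennreal_plus ennreal_mult)
  qed
  also have "\<dots> = ennreal c * (\<integral>\<^sup>+ z \<in> A. ennreal (w z powr r) \<partial>lebesgue) + ennreal d * emeasure lebesgue A"
    by (simp add: nn_integral_add nn_integral_cmult)
  also have "\<dots> \<le> ennreal c * (emeasure lebesgue A * ennreal (m powr r)) + ennreal d * emeasure lebesgue A"
    using le A by (intro add_mono mult_left_mono) (auto simp: average_le_iff)
  also have "\<dots> = emeasure lebesgue A * ennreal (c * m powr r + d)"
    using cd by (simp add: ennreal_plus ennreal_mult algebra_simps)
  also have "c * m powr r + d = m"
    using \<open>1 < r\<close> \<open>0 < m\<close> by (simp add: c_def d_def field_simps)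
  finally show ?thesis
    using A by (simp add: average_le_iff)
qed

lemma esssup_restrict_le_iff:
  fixes f :: "'a \<Rightarrow> ennreal"
  assumes "f \<in> borel_measurable M" "A \<in> sets M"
  shows "esssup (restrict_space M A) f \<le> B \<longleftrightarrow> (AE z in M. z \<in> A \<longrightarrow> f z \<le> B)"
proof -
  have *: "(AE z in restrict_space M A. f z \<le> B) \<longleftrightarrow> (AE z in M. z \<in> A \<longrightarrow> f z \<le> B)"
    using assms by (intro AE_restrict_space_iff) auto
  show ?thesis
  proof
    assume "esssup (restrict_space M A) f \<le> B"
    then have "AE z in restrict_space M A. f z \<le> B"
      by (intro eventually_mono[OF esssup_AE]) (rule order_trans)
    then show "AE z in M. z \<in> A \<longrightarrow> f z \<le> B"
      using * by simp
  next
    assume "AE z in M. z \<in> A \<longrightarrow> f z \<le> B"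
    then show "esssup (restrict_space M A) f \<le> B"
      using * assms by (intro esssup_I measurable_restrict_space1) auto
  qed
qed

lemma q_average_le_iff:
  fixes w :: "'a::euclidean_space \<Rightarrow> real"
  assumes "1 < q" "q \<noteq> \<infinity>" "0 \<le> m"
  shows "q_average q A w \<le> ennreal m \<longleftrightarrow>
    average A (\<lambda>z. w z powr enn2real q) \<le> ennreal (m powr enn2real q)"
proof -
  have "0 < enn2real q"
    using one_less_enn2real[OF assms(1,2)] by simp
  then show ?thesis
    using assms by (simp add: q_average_finite ennreal_powr_le_iff)
qed

text \<open>For \<open>q = \<infinity>\<close> the almost everywhere bound by the essential supremum
  is integrated; for finite \<open>q\<close> this is the power mean inequality.\<close>

lemma average_le_q_average:
  fixes w :: "'a::euclidean_space \<Rightarrow> real"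
  assumes A: "A \<in> sets lebesgue" "0 < emeasure lebesgue A" "emeasure lebesgue A < \<infinity>"
    and w [measurable]: "w \<in> borel_measurable lebesgue" and nonneg: "\<And>z. 0 \<le> w z"
    and "1 < q"
  shows "average A w \<le> q_average q A w"
proof (cases "q = \<infinity>")
  case True
  have AE: "AE z in lebesgue. z \<in> A \<longrightarrow> ennreal (w z) \<le> q_average q A w"
    using esssup_restrict_le_iff[of "\<lambda>z. ennreal (w z)" lebesgue A "q_average q A w"] A(1)
    by (simp add: q_average_def True)
  have "(\<integral>\<^sup>+ z \<in> A. ennreal (w z) \<partial>lebesgue) \<le> (\<integral>\<^sup>+ z. q_average q A w * indicator A z \<partial>lebesgue)"
    by (intro nn_integral_mono_AE eventually_mono[OF AE]) (simp add: indicator_def)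
  then show ?thesis
    using A by (simp only: average_le_iff nn_integral_cmult_indicator) (simp only: mult.commute)
next
  case False
  have r: "1 < enn2real q"
    using \<open>1 < q\<close> False by (simp add: one_less_enn2real)
  show ?thesis
    \<comment> \<open>The margin \<open>e\<close> is needed because the \<open>q\<close>-average can vanish.\<close>
  proof (rule ennreal_le_epsilon)
    fix e :: real
    assume "q_average q A w < top" "0 < e"
    define m where "m = enn2real (q_average q A w)"
    have m: "q_average q A w = ennreal m" "0 \<le> m"
      using \<open>q_average q A w < top\<close> by (simp_all add: m_def)
    then have "q_average q A w \<le> ennreal (m + e)"
      using \<open>0 < e\<close> by (simp add: ennreal_leI)
    then have "average A (\<lambda>z. w z powr enn2real q) \<le> ennreal ((m + e) powr enn2real q)"
      using q_average_le_iff[of q "m + e" A w] \<open>1 < q\<close> False m \<open>0 < e\<close> by simp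
    then have "average A w \<le> ennreal (m + e)"
      using m \<open>0 < e\<close> by (intro average_le_of_powr[OF A w nonneg r]) auto
    then show "average A w \<le> q_average q A w + ennreal e"
      using m \<open>0 < e\<close> by (simp add: ennreal_plus)
  qed
qed

section \<open>Averages over covers and over subsets\<close>

text \<open>For finite \<open>q\<close> the integrals over the pieces are added, and no piece has
  larger measure than \<open>A\<close>; for \<open>q = \<infinity>\<close> finitely many null sets
  are combined. The factor \<open>card I\<close> serves all \<open>q\<close> at once.\<close>

lemma q_average_le_of_cover:
  fixes w :: "'a::euclidean_space \<Rightarrow> real"
  assumes I: "finite I" "A \<subseteq> (\<Union>i\<in>I. S i)"
    and A: "A \<in> sets lebesgue" "0 < emeasure lebesgue A" "emeasure lebesgue A < \<infinity>"
    and S: "\<And>i. i \<in> I \<Longrightarrow> S i \<in> sets lebesgue" "\<And>i. i \<in> I \<Longrightarrow> 0 < emeasure lebesgue (S i)"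
      "\<And>i. i \<in> I \<Longrightarrow> emeasure lebesgue (S i) \<le> emeasure lebesgue A"
    and w [measurable]: "w \<in> borel_measurable lebesgue"
    and "1 < q"
    and le: "\<And>i. i \<in> I \<Longrightarrow> q_average q (S i) w \<le> B"
  shows "q_average q A w \<le> of_nat (card I) * B"
proof -
  \<comment> \<open>Positive measure excludes an empty index set, for which the factor
    \<open>card I\<close> would be 0, also in the product with
    \<open>B = \<infinity>\<close>.\<close>
  have "A \<noteq> {}"
    using A(2) by auto
  then have "I \<noteq> {}"
    using I by auto
  then have card: "1 \<le> card I"
    using I by (simp add: Suc_le_eq card_gt_0_iff)
  show ?thesis
  proof (cases "q = \<infinity>")
    case True
    have "AE z in lebesgue. \<forall>i\<in>I. z \<in> S i \<longrightarrow> ennreal (w z) \<le> B"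
    proof (rule AE_finite_allI[OF I(1)])
      fix i assume "i \<in> I"
      then show "AE z in lebesgue. z \<in> S i \<longrightarrow> ennreal (w z) \<le> B"
        using le[of i] esssup_restrict_le_iff[of "\<lambda>z. ennreal (w z)" lebesgue "S i" B] S
        by (simp add: q_average_def True)
    qed
    then have "AE z in lebesgue. z \<in> A \<longrightarrow> ennreal (w z) \<le> B"
      by eventually_elim (use I(2) in auto)
    then have "q_average q A w \<le> 1 * B"
      using A by (simp add: q_average_def True esssup_restrict_le_iff)
    also have "\<dots> \<le> of_nat (card I) * B"
      using card by (intro mult_right_mono) auto
    finally show ?thesis .
  next
    case False
    have r: "1 < enn2real q"
      using \<open>1 < q\<close> False by (simp add: one_less_enn2real)
    show ?thesis
    proof (cases B)
      case (real b)
      let ?f = "\<lambda>z. w z powr enn2real q"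
      have "(\<integral>\<^sup>+ z \<in> A. ennreal (?f z) \<partial>lebesgue) \<le> (\<integral>\<^sup>+ z. (\<Sum>i\<in>I. ennreal (?f z) * indicator (S i) z) \<partial>lebesgue)"
      proof (rule nn_integral_mono)
        fix z
        show "ennreal (?f z) * indicator A z \<le> (\<Sum>i\<in>I. ennreal (?f z) * indicator (S i) z)"
        proof (cases "z \<in> A")
          case True
          then obtain i where i: "i \<in> I" "z \<in> S i"
            using I by auto
          have "ennreal (?f z) * indicator (S i) z \<le> (\<Sum>i\<in>I. ennreal (?f z) * indicator (S i) z)"
            using i I by (intro member_le_sum) auto
          then show ?thesis
            using True i by simp
        qed simp
      qed
      also have "\<dots> = (\<Sum>i\<in>I. \<integral>\<^sup>+ z \<in> S i. ennreal (?f z) \<partial>lebesgue)"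
        using S by (intro nn_integral_sum) auto
      also have "\<dots> \<le> (\<Sum>i\<in>I. emeasure lebesgue A * ennreal (b powr enn2real q))"
      proof (rule sum_mono)
        fix i assume i: "i \<in> I"
        have "average (S i) ?f \<le> ennreal (b powr enn2real q)"
          using le[OF i] real False \<open>1 < q\<close> by (simp add: q_average_le_iff)
        then have "(\<integral>\<^sup>+ z \<in> S i. ennreal (?f z) \<partial>lebesgue) \<le> emeasure lebesgue (S i) * ennreal (b powr enn2real q)"
          by (rule average_le_iff[OF S(2)[OF i] le_less_trans[OF S(3)[OF i] A(3)], THEN iffD1])
        also have "\<dots> \<le> emeasure lebesgue A * ennreal (b powr enn2real q)"
          using S[OF i] by (intro mult_right_mono) auto
        finally show "(\<integral>\<^sup>+ z \<in> S i. ennreal (?f z) \<partial>lebesgue) \<le> \<dots>" .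
      qed
      also have "\<dots> = emeasure lebesgue A * ennreal (real (card I) * b powr enn2real q)"
        by (simp add: ennreal_mult ennreal_of_nat_eq_real_of_nat ac_simps)
      also have "\<dots> \<le> emeasure lebesgue A * ennreal ((real (card I) * b) powr enn2real q)"
      proof (intro mult_left_mono ennreal_leI)
        \<comment> \<open>As \<open>card I\<close> is at least 1 and the exponent exceeds 1, the
          factor can be moved inside the power.\<close>
        have "real (card I) powr 1 \<le> real (card I) powr enn2real q"
          using card r by (intro powr_mono) auto
        then show "real (card I) * b powr enn2real q \<le> (real (card I) * b) powr enn2real q"
          by (simp add: powr_mult mult_right_mono)
      qed simp
      finally have "average A ?f \<le> ennreal ((real (card I) * b) powr enn2real q)"
        using A by (simp add: average_le_iff)
      then have "q_average q A w \<le> ennreal (real (card I) * b)"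
        using real False \<open>1 < q\<close> by (simp add: q_average_le_iff)
      then show ?thesis
        using real by (simp add: ennreal_mult ennreal_of_nat_eq_real_of_nat)
    next
      case top
      then show ?thesis
        using card by (simp add: ennreal_mult_top)
    qed
  qed
qed

text \<open>The integral grows with the set, and \<open>c\<close> compensates for the change of the
  normalizing measure.\<close>

lemma average_le_of_subset:
  assumes "S \<subseteq> A"
    and S: "0 < emeasure lebesgue S"
    and A: "emeasure lebesgue A < \<infinity>" "emeasure lebesgue A \<le> ennreal c * emeasure lebesgue S"
    "S \<in> sets lebesgue" "A \<in> sets lebesgue"
  shows "average S f \<le> ennreal c * average A f"
proof -
  have SA: "emeasure lebesgue S \<le> emeasure lebesgue A"
    using assms by (intro emeasure_mono) auto
  then have fin: "0 < emeasure lebesgue A" "emeasure lebesgue S < \<infinity>"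
    using less_le_trans[OF S SA] le_less_trans[OF SA A(1)] by simp_all
  have "(\<integral>\<^sup>+ z \<in> S. ennreal (f z) \<partial>lebesgue) \<le> (\<integral>\<^sup>+ z \<in> A. ennreal (f z) \<partial>lebesgue)"
    using \<open>S \<subseteq> A\<close> by (intro nn_integral_mono) (auto simp: indicator_def)
  also have "\<dots> \<le> emeasure lebesgue A * average A f"
    by (rule average_le_iff[OF fin(1) A(1), THEN iffD1]) simp
  also have "\<dots> \<le> ennreal c * emeasure lebesgue S * average A f"
    using A by (intro mult_right_mono) auto
  also have "\<dots> = emeasure lebesgue S * (ennreal c * average A f)"
    by (simp only: ac_simps)
  finally show ?thesis
    by (rule average_le_iff[OF S fin(2), THEN iffD2])
qed

section \<open>Measure of the parts of a parabolic rectangle\<close>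

lemma cube_eq_cbox: "cube x L = cbox (\<chi> i. x $ i - L / 2) (\<chi> i. x $ i + L / 2)"
proof -
  have "\<bar>a - b\<bar> \<le> L / 2 \<longleftrightarrow> b - L / 2 \<le> a \<and> a \<le> b + L / 2" for a b :: real
    by linarith
  then show ?thesis
    by (simp add: cube_def set_eq_iff mem_box_cart)
qed

lemma emeasure_cube:
  fixes x :: "real ^ 'n"
  assumes "0 \<le> L"
  shows "emeasure lborel (cube x L) = ennreal (L ^ CARD('n))"
proof -
  have "cube x L \<noteq> {}"
    using assms by (auto simp: cube_def intro!: exI[of _ x])
  then have "measure lborel (cube x L) = L ^ CARD('n)"
    unfolding cube_eq_cbox by (subst content_cbox_cart) auto
  then show ?thesis
    unfolding cube_eq_cbox
    by (subst emeasure_eq_ennreal_measure) (simp_all add: less_imp_neq[OF emeasure_lborel_cbox_finite, unfolded infinity_ennreal_def])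
qed

lemma sets_lower_part [measurable]: "lower_part p \<gamma> x t L \<in> sets lebesgue"
proof -
  have "lower_part p \<gamma> x t L \<in> sets borel"
    unfolding lower_part_def cube_eq_cbox by (intro borel_Times) auto
  then show ?thesis
    by (intro sets_completionI_sets) simp
qed

lemma emeasure_lower_part:
  fixes x :: "real ^ 'n"
  assumes "0 \<le> L" "\<gamma> \<le> 1"
  shows "emeasure lebesgue (lower_part p \<gamma> x t L) = ennreal (L ^ CARD('n) * ((1 - \<gamma>) * L powr p))"
proof -
  have "\<gamma> * L powr p \<le> L powr p"
    using assms mult_right_mono[of \<gamma> 1 "L powr p"] by simp
  moreover have "lower_part p \<gamma> x t L \<in> sets borel"
    unfolding lower_part_def cube_eq_cbox by (intro borel_Times) auto
  moreover have "emeasure (lborel \<Otimes>\<^sub>M lborel) (lower_part p \<gamma> x t L) =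
     emeasure lborel (cube x L) * emeasure lborel {t - L powr p <..< t - \<gamma> * L powr p}"
    unfolding lower_part_def cube_eq_cbox by (intro lborel.emeasure_pair_measure_Times) auto
  ultimately have "emeasure lebesgue (lower_part p \<gamma> x t L) =
      ennreal (L ^ CARD('n)) * ennreal (L powr p - \<gamma> * L powr p)"
    using assms by (simp add: lborel_prod emeasure_cube emeasure_completion)
  also have "\<dots> = ennreal (L ^ CARD('n) * ((1 - \<gamma>) * L powr p))"
    using \<open>\<gamma> * L powr p \<le> L powr p\<close> assms by (subst ennreal_mult) (auto simp: left_diff_distrib)
  finally show ?thesis .
qed

lemma emeasure_lower_part_pos_finite:
  assumes "0 < L" "\<gamma> < 1"
  shows "0 < emeasure lebesgue (lower_part p \<gamma> x t L)" "emeasure lebesgue (lower_part p \<gamma> x t L) < \<infinity>"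
  using assms by (simp_all add: emeasure_lower_part del: emeasure_completion)

text \<open>With \<open>h = L powr p\<close>, both parts have height
  \<open>(1 - \<gamma>) * h\<close>, and their bottoms \<open>t - h\<close> and
  \<open>t + \<gamma> * h\<close> differ by \<open>(1 + \<gamma>) * h\<close>. Facts about lower
  parts thus transfer to upper parts.\<close>

lemma upper_part_eq_lower_part:
  "upper_part p \<gamma> x t L = lower_part p \<gamma> x (t + (1 + \<gamma>) * L powr p) L"
  by (simp add: upper_part_def lower_part_def algebra_simps)

section \<open>Small rectangles: covering in space and time, and landing after translation\<close>

text \<open>The index \<open>m\<close> is a position in the grid of \<open>N\<close> cells per axis,
  counted from 0 at the lowest corner; the summand 1/2 leads to the midpoint of a cell.\<close>

definition subcube_center :: "nat \<Rightarrow> real ^ 'n \<Rightarrow> real \<Rightarrow> ('n \<Rightarrow> nat) \<Rightarrow> real ^ 'n" where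
  "subcube_center N x L m = (\<chi> i. x $ i - L / 2 + (real (m i) + 1 / 2) * (L / real N))"

text \<open>The floor of \<open>u\<close> is the index, except at \<open>u = N\<close>, where it
  would be too large by one; the last closed cell contains this end point.\<close>

lemma ex_unit_interval:
  assumes "0 < N" "0 \<le> u" "u \<le> real N"
  shows "\<exists>m<N. real m \<le> u \<and> u \<le> real m + 1"
proof (cases "u = real N")
  case True
  then show ?thesis
    using assms by (intro exI[of _ "N - 1"]) auto
next
  case False
  then have "nat \<lfloor>u\<rfloor> < N"
    using assms by linarith
  then show ?thesis
    using assms by (intro exI[of _ "nat \<lfloor>u\<rfloor>"]) linarith
qed

text \<open>In each coordinate the distance to the lower face, in units of \<open>L / N\<close>,
  selects a cell.\<close>

lemma cube_subset_subcubes: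
  fixes x :: "real ^ 'n"
  assumes "0 < N" "0 < L"
  shows "cube x L \<subseteq> (\<Union>m \<in> UNIV \<rightarrow>\<^sub>E {..<N}. cube (subcube_center N x L m) (L / real N))"
proof
  fix y assume y: "y \<in> cube x L"
  have "\<exists>m<N. real m \<le> (y $ i - x $ i + L / 2) / (L / real N) \<and>
      (y $ i - x $ i + L / 2) / (L / real N) \<le> real m + 1" for i
  proof (rule ex_unit_interval[OF \<open>0 < N\<close>])
    have *: "0 \<le> y $ i - x $ i + L / 2" "y $ i - x $ i + L / 2 \<le> L"
    proof -
      have "\<bar>y $ i - x $ i\<bar> \<le> L / 2"
        using y unfolding cube_def by blast
      then show "0 \<le> y $ i - x $ i + L / 2" "y $ i - x $ i + L / 2 \<le> L"
        by linarith+
    qed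
    then show "0 \<le> (y $ i - x $ i + L / 2) / (L / real N)"
      using assms by auto
    show "(y $ i - x $ i + L / 2) / (L / real N) \<le> real N"
      using * assms by (simp add: pos_divide_le_eq)
  qed
  then obtain m where m: "\<And>i. m i < N"
      "\<And>i. real (m i) \<le> (y $ i - x $ i + L / 2) / (L / real N)"
      "\<And>i. (y $ i - x $ i + L / 2) / (L / real N) \<le> real (m i) + 1"
    by metis
  have "\<bar>y $ i - subcube_center N x L m $ i\<bar> \<le> L / real N / 2" for i
  proof -
    define l where "l = L / real N"
    have "0 < l"
      using assms by (simp add: l_def)
    then have "real (m i) * l \<le> y $ i - x $ i + L / 2" "y $ i - x $ i + L / 2 \<le> (real (m i) + 1) * l"
      using m(2,3)[of i] by (simp_all add: pos_le_divide_eq pos_divide_le_eq flip: l_def)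
    then show ?thesis
      unfolding subcube_center_def abs_le_iff vec_lambda_beta distrib_right l_def[symmetric] by linarith
  qed
  then show "y \<in> (\<Union>m \<in> UNIV \<rightarrow>\<^sub>E {..<N}. cube (subcube_center N x L m) (L / real N))"
    using m(1) by (auto simp: cube_def intro!: bexI[of _ m])
qed

text \<open>Translation in time leaves the spatial cube fixed, so this settles the spatial half of
  the inclusion of a translate in the upper part.\<close>

lemma subcube_subset:
  fixes x :: "real ^ 'n"
  assumes "0 < L" and m: "m \<in> UNIV \<rightarrow>\<^sub>E {..<N}"
  shows "cube (subcube_center N x L m) (L / real N) \<subseteq> cube x L"
proof
  fix y assume y: "y \<in> cube (subcube_center N x L m) (L / real N)"
  have "\<bar>y $ i - x $ i\<bar> \<le> L / 2" for i
  proof -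
    define l where "l = L / real N"
    have "m i < N"
      using m by auto
    then have l: "0 < l" "L = real N * l"
      using assms by (auto simp: l_def)
    have "0 \<le> real (m i) * l" "(real (m i) + 1) * l \<le> real N * l"
      using \<open>m i < N\<close> l(1) by (auto intro!: mult_right_mono)
    moreover have "\<bar>y $ i - (x $ i - L / 2 + (real (m i) + 1 / 2) * l)\<bar> \<le> l / 2"
      using y by (auto simp: cube_def subcube_center_def l_def)
    ultimately show ?thesis
      unfolding l(2)[symmetric] abs_le_iff distrib_right by linarith
  qed
  then show "y \<in> cube x L"
    by (simp add: cube_def)
qed

text \<open>The time slices are open intervals of length \<open>a\<close>; consecutive ones are shifted by \<open>a / 2\<close>, so that
  their end points are covered too.\<close>

lemma lower_part_subset_slices:
  fixes x :: "real ^ 'n" and p :: real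
  assumes "0 < N" "0 < L" "\<gamma>\<^sub>1 < 1" "0 \<le> \<gamma>\<^sub>2"
  defines "l \<equiv> L / real N"
  defines "a \<equiv> (1 - \<gamma>\<^sub>1) * l powr p"
  shows "lower_part p \<gamma>\<^sub>2 x t L \<subseteq>
    (\<Union>(m, j) \<in> (UNIV \<rightarrow>\<^sub>E {..<N}) \<times> {..nat \<lfloor>2 * real N powr p / (1 - \<gamma>\<^sub>1)\<rfloor>}.
      lower_part p \<gamma>\<^sub>1 (subcube_center N x L m) (t - L powr p + (real j - 1) * (a / 2) + l powr p) l)"
proof
  fix z assume "z \<in> lower_part p \<gamma>\<^sub>2 x t L"
  then obtain y u where z: "z = (y, u)" and y: "y \<in> cube x L"
    and u: "t - L powr p < u" "u < t - \<gamma>\<^sub>2 * L powr p"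
    by (auto simp: lower_part_def)
  obtain m where m: "m \<in> UNIV \<rightarrow>\<^sub>E {..<N}" "y \<in> cube (subcube_center N x L m) l"
    using cube_subset_subcubes[of N L x] y assms by auto
  have a: "0 < a"
    using assms by (simp add: a_def l_def)
  have "0 \<le> \<gamma>\<^sub>2 * L powr p"
    using assms by simp
  then have ut: "u < t"
    using u by linarith
  \<comment> \<open>Height of \<open>u\<close> above the bottom \<open>t - L powr p\<close> in units
    of half a slice. Slice number \<open>j\<close> starts at \<open>j - 1\<close> such units and
    ends at \<open>j + 1\<close>, so the slice numbered by the floor of \<open>v\<close> contains
    \<open>u\<close> in its interior.\<close>
  define v where "v = (u - (t - L powr p)) / (a / 2)"
  have v: "0 \<le> v" "v * (a / 2) = u - (t - L powr p)"
    using a u by (simp_all add: v_def)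
  have "v \<le> L powr p / (a / 2)"
    unfolding v_def using a ut by (intro divide_right_mono) auto
  also have "\<dots> = 2 * real N powr p / (1 - \<gamma>\<^sub>1)"
    using assms by (simp add: a_def l_def powr_divide)
  finally have "nat \<lfloor>v\<rfloor> \<le> nat \<lfloor>2 * real N powr p / (1 - \<gamma>\<^sub>1)\<rfloor>"
    by (intro nat_mono floor_mono)
  moreover have "(y, u) \<in> lower_part p \<gamma>\<^sub>1 (subcube_center N x L m)
      (t - L powr p + (real (nat \<lfloor>v\<rfloor>) - 1) * (a / 2) + l powr p) l"
  proof -
    have "real (nat \<lfloor>v\<rfloor>) * (a / 2) \<le> v * (a / 2)" "v * (a / 2) < (real (nat \<lfloor>v\<rfloor>) + 1) * (a / 2)"
      using a v(1) by (auto intro!: mult_right_mono mult_strict_right_mono)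
    then have "t - L powr p + (real (nat \<lfloor>v\<rfloor>) - 1) * (a / 2) < u"
        "u < t - L powr p + (real (nat \<lfloor>v\<rfloor>) - 1) * (a / 2) + a"
      unfolding v(2) distrib_right left_diff_distrib using a by linarith+
    then show ?thesis
      using m by (simp add: lower_part_def a_def left_diff_distrib)
  qed
  ultimately show "z \<in> (\<Union>(m, j) \<in> (UNIV \<rightarrow>\<^sub>E {..<N}) \<times> {..nat \<lfloor>2 * real N powr p / (1 - \<gamma>\<^sub>1)\<rfloor>}.
      lower_part p \<gamma>\<^sub>1 (subcube_center N x L m) (t - L powr p + (real j - 1) * (a / 2) + l powr p) l)"
    using m(1) z by (intro UN_I[of "(m, nat \<lfloor>v\<rfloor>)"]) auto
qed

text \<open>Here \<open>b\<close> is the bottom of a slice of height \<open>(1 - \<gamma>\<^sub>1) * h\<close>. A step and a slice together have length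
  \<open>2 * h\<close>, so the first translate to reach \<open>t + \<gamma>\<^sub>2 * H\<close> is still below \<open>t + H\<close>.\<close>

lemma ex_landing_time:
  fixes h H \<gamma>\<^sub>1 \<gamma>\<^sub>2 b t :: real
  assumes "0 < h" "0 \<le> \<gamma>\<^sub>1" "0 \<le> \<gamma>\<^sub>2" "2 * h \<le> (1 - \<gamma>\<^sub>2) * H" "t - H - h \<le> b" "b \<le> t" "0 \<le> H"
  shows "\<exists>k \<le> nat \<lfloor>2 * (H / h) + 1\<rfloor>. t + \<gamma>\<^sub>2 * H \<le> b + real (Suc k) * ((1 + \<gamma>\<^sub>1) * h) \<and>
    b + real (Suc k) * ((1 + \<gamma>\<^sub>1) * h) + (1 - \<gamma>\<^sub>1) * h \<le> t + H"
proof -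
  define d where "d = (1 + \<gamma>\<^sub>1) * h"
  have d: "h \<le> d" "0 < d"
    using assms by (simp_all add: d_def distrib_right add_pos_nonneg)
  \<comment> \<open>Number of steps, as a real number, from \<open>b\<close> to the target
    \<open>t + \<gamma>\<^sub>2 * H\<close>. The successor of its floor reaches the target and
    overshoots by at most one step \<open>d\<close>.\<close>
  define v where "v = (t + \<gamma>\<^sub>2 * H - b) / d"
  have "0 \<le> \<gamma>\<^sub>2 * H"
    using assms by simp
  then have pos: "0 \<le> t + \<gamma>\<^sub>2 * H - b"
    using assms by linarith
  then have v: "0 \<le> v" "v * d = t + \<gamma>\<^sub>2 * H - b"
    using d by (simp_all add: v_def)
  have "v \<le> (t + \<gamma>\<^sub>2 * H - b) / h"
    unfolding v_def using pos d \<open>0 < h\<close> by (intro divide_left_mono) auto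
  also have "\<dots> \<le> (2 * H + h) / h"
    using assms by (intro divide_right_mono) (auto simp: algebra_simps)
  also have "\<dots> = 2 * (H / h) + 1"
    using \<open>0 < h\<close> by (simp add: field_simps)
  finally have "nat \<lfloor>v\<rfloor> \<le> nat \<lfloor>2 * (H / h) + 1\<rfloor>"
    by (intro nat_mono floor_mono)
  moreover have "v * d \<le> real (Suc (nat \<lfloor>v\<rfloor>)) * d" "real (Suc (nat \<lfloor>v\<rfloor>)) * d \<le> (v + 1) * d"
  proof -
    have "v \<le> real (Suc (nat \<lfloor>v\<rfloor>))" "real (Suc (nat \<lfloor>v\<rfloor>)) \<le> v + 1"
      using v(1) by linarith+
    then show "v * d \<le> real (Suc (nat \<lfloor>v\<rfloor>)) * d" "real (Suc (nat \<lfloor>v\<rfloor>)) * d \<le> (v + 1) * d"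
      using d by (simp_all only: mult_right_mono less_imp_le)
  qed
  then have "t + \<gamma>\<^sub>2 * H \<le> b + real (Suc (nat \<lfloor>v\<rfloor>)) * d"
      "b + real (Suc (nat \<lfloor>v\<rfloor>)) * d \<le> t + \<gamma>\<^sub>2 * H + d"
    using v(2) by (simp_all add: algebra_simps)
  moreover have "d + (1 - \<gamma>\<^sub>1) * h = 2 * h"
    by (simp add: d_def algebra_simps)
  ultimately show ?thesis
    unfolding d_def[symmetric] using assms
    by (intro exI[of _ "nat \<lfloor>v\<rfloor>"]) (auto simp: algebra_simps)
qed

section \<open>Iteration of the estimate and change of the gap\<close>

text \<open>Each further step bounds the average over the current translate by its
  \<open>q\<close>-average and applies \<open>gap\<close> there. The count is \<open>Suc k\<close>
  because one application is needed to pass from a \<open>q\<close>-average to an average.\<close>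

lemma q_average_shift_iterate:
  fixes w :: "(real ^ 'n) \<times> real \<Rightarrow> real"
  assumes w: "weight w" and "1 < q" "0 < L" "\<gamma> < 1"
    and gap: "\<And>x t. q_average q (lower_part p \<gamma> x t L) w \<le> C * average (upper_part p \<gamma> x t L) w"
  shows "q_average q (lower_part p \<gamma> x t L) w \<le>
    C ^ Suc k * average (lower_part p \<gamma> x (t + real (Suc k) * ((1 + \<gamma>) * L powr p)) L) w"
proof (induction k)
  case 0
  then show ?case
    using gap[of x t] by (simp add: upper_part_eq_lower_part)
next
  case (Suc k)
  define s where "s = t + real (Suc k) * ((1 + \<gamma>) * L powr p)"
  have "average (lower_part p \<gamma> x s L) w \<le> q_average q (lower_part p \<gamma> x s L) w"
    using assms by (intro average_le_q_average emeasure_lower_part_pos_finite sets_lower_part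
        weight_measurable weight_nonneg)
  also have "\<dots> \<le> C * average (lower_part p \<gamma> x (s + (1 + \<gamma>) * L powr p) L) w"
    using gap[of x s] by (simp add: upper_part_eq_lower_part)
  also have "s + (1 + \<gamma>) * L powr p = t + real (Suc (Suc k)) * ((1 + \<gamma>) * L powr p)"
    by (simp add: s_def algebra_simps)
  finally have "C ^ Suc k * average (lower_part p \<gamma> x s L) w \<le>
      C ^ Suc k * (C * average (lower_part p \<gamma> x (t + real (Suc (Suc k)) * ((1 + \<gamma>) * L powr p)) L) w)"
    by (rule mult_left_mono) simp
  also have "\<dots> = C ^ Suc (Suc k) * average (lower_part p \<gamma> x (t + real (Suc (Suc k)) * ((1 + \<gamma>) * L powr p)) L) w"
    by (simp only: power_Suc ac_simps)
  finally show ?case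
    using Suc.IH unfolding s_def by (rule order_trans[rotated])
qed

definition reverse_holder_gap :: "real \<Rightarrow> ennreal \<Rightarrow> real \<Rightarrow> ((real ^ 'n) \<times> real \<Rightarrow> real) \<Rightarrow> bool" where
  "reverse_holder_gap p q \<gamma> w \<longleftrightarrow> (\<exists>C::real. 0 \<le> C \<and> (\<forall>x t L. 0 < L \<longrightarrow>
     q_average q (lower_part p \<gamma> x t L) w \<le> ennreal C * average (upper_part p \<gamma> x t L) w))"

text \<open>The new constant is the product of the number of pieces, a power of the old constant for
  the number of steps, and a ratio of measures. By parabolic scaling none of these depends on
  \<open>x\<close>, \<open>t\<close> or \<open>L\<close>.\<close>

lemma reverse_holder_gap_change:
  fixes w :: "(real ^ 'n) \<times> real \<Rightarrow> real"
  assumes "1 \<le> p" "1 < q" "0 \<le> \<gamma>\<^sub>1" "\<gamma>\<^sub>1 < 1" "0 \<le> \<gamma>\<^sub>2" "\<gamma>\<^sub>2 < 1" and w: "weight w"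
    and gap: "reverse_holder_gap p q \<gamma>\<^sub>1 w"
  shows "reverse_holder_gap p q \<gamma>\<^sub>2 w"
proof -
  obtain C\<^sub>0 where C\<^sub>0: "0 \<le> C\<^sub>0" "\<And>x t L. 0 < L \<Longrightarrow>
      q_average q (lower_part p \<gamma>\<^sub>1 x t L) w \<le> ennreal C\<^sub>0 * average (upper_part p \<gamma>\<^sub>1 x t L) w"
    using gap by (auto simp: reverse_holder_gap_def)
  \<comment> \<open>A constant of at least 1 has increasing powers, so \<open>C ^ K\<close> covers
    every smaller number of steps.\<close>
  define C where "C = max 1 C\<^sub>0"
  have C: "q_average q (lower_part p \<gamma>\<^sub>1 x t L) w \<le> ennreal C * average (upper_part p \<gamma>\<^sub>1 x t L) w"
    if "0 < L" for x t L
    using C\<^sub>0(2)[OF that, of x t] by (rule order_trans) (auto simp: C_def intro!: mult_right_mono ennreal_leI)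
  have C1: "1 \<le> C"
    by (simp add: C_def)
  \<comment> \<open>Together with \<open>1 \<le> p\<close> this yields
    \<open>2 * h \<le> (1 - \<gamma>\<^sub>2) * H\<close> below, the room that
    \<open>ex_landing_time\<close> requires.\<close>
  obtain N :: nat where N: "2 / (1 - \<gamma>\<^sub>2) \<le> real N"
    using real_arch_simple by blast
  have "2 \<le> (1 - \<gamma>\<^sub>2) * real N"
    using N assms by (simp add: field_simps)
  then have N0: "0 < N"
    by (cases N) auto
  define D where "D = real N powr p"
  have "real N powr 1 \<le> D"
    unfolding D_def using N0 assms by (intro powr_mono) auto
  then have "(1 - \<gamma>\<^sub>2) * real N \<le> (1 - \<gamma>\<^sub>2) * D"
    using assms by (intro mult_left_mono) auto
  with \<open>2 \<le> (1 - \<gamma>\<^sub>2) * real N\<close> have D: "2 \<le> (1 - \<gamma>\<^sub>2) * D"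
    by linarith
  have D0: "0 < D"
    using N0 by (simp add: D_def)
  define I where "I = (UNIV \<rightarrow>\<^sub>E {..<N} :: ('n \<Rightarrow> nat) set) \<times> {..nat \<lfloor>2 * D / (1 - \<gamma>\<^sub>1)\<rfloor>}"
  \<comment> \<open>\<open>D\<close> will be the ratio \<open>H / h\<close>, so this is the bound of
    \<open>ex_landing_time\<close> for \<open>k\<close>, raised by one for the \<open>Suc k\<close>
    steps.\<close>
  define K where "K = Suc (nat \<lfloor>2 * D + 1\<rfloor>)"
  \<comment> \<open>Exact ratio of the measure of a part with side \<open>L\<close> and gap
    \<open>\<gamma>\<^sub>2\<close> to that of a part with side \<open>L / N\<close> and gap
    \<open>\<gamma>\<^sub>1\<close>.\<close>
  define c where "c = real N ^ CARD('n) * (D * ((1 - \<gamma>\<^sub>2) / (1 - \<gamma>\<^sub>1)))"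
  have c: "0 \<le> c"
    using assms D0 by (simp add: c_def)
  have "q_average q (lower_part p \<gamma>\<^sub>2 x t L) w \<le>
      ennreal (real (card I) * (C ^ K * c)) * average (upper_part p \<gamma>\<^sub>2 x t L) w"
    if L: "0 < L" for x :: "real ^ 'n" and t L
  proof -
    define l where "l = L / real N"
    define h where "h = l powr p"
    define H where "H = L powr p"
    define a where "a = (1 - \<gamma>\<^sub>1) * h"
    define s where "s j = t - H + (real j - 1) * (a / 2) + h" for j :: nat
    have l: "0 < l"
      using L N0 by (simp add: l_def)
    then have h: "0 < h"
      by (simp add: h_def)
    have Hh: "H = D * h"
      using N0 by (simp add: H_def h_def D_def l_def powr_divide)
    have H0: "0 \<le> H"
      by (simp add: H_def)
    have Ll: "L = real N * l"
      using N0 by (simp add: l_def)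
    have a: "0 < a" "a \<le> h"
      using assms h by (simp_all add: a_def mult_left_le_one_le)
    have measR: "emeasure lebesgue (lower_part p \<gamma>\<^sub>2 y u L) = ennreal c * emeasure lebesgue (lower_part p \<gamma>\<^sub>1 z v l)"
      for y z :: "real ^ 'n" and u v
    proof -
      have "c * (l ^ CARD('n) * ((1 - \<gamma>\<^sub>1) * h)) = L ^ CARD('n) * ((1 - \<gamma>\<^sub>2) * H)"
        using assms by (simp add: c_def Hh Ll power_mult_distrib)
      then show ?thesis
        using assms l c h unfolding emeasure_lower_part[OF less_imp_le[OF L] less_imp_le[OF \<open>\<gamma>\<^sub>2 < 1\<close>]]
          emeasure_lower_part[OF less_imp_le[OF l] less_imp_le[OF \<open>\<gamma>\<^sub>1 < 1\<close>]] h_def[symmetric] H_def[symmetric]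
        by (subst ennreal_mult[symmetric]) auto
    qed
    have measS: "emeasure lebesgue (lower_part p \<gamma>\<^sub>1 z v l) \<le> emeasure lebesgue (lower_part p \<gamma>\<^sub>2 y u L)"
      for y z :: "real ^ 'n" and u v
    proof -
      have "l * 1 \<le> l * real N"
        using N0 l by (intro mult_left_mono) auto
      then have "l ^ CARD('n) \<le> L ^ CARD('n)"
        using l by (intro power_mono) (auto simp: Ll mult.commute)
      moreover have "(1 - \<gamma>\<^sub>1) * h \<le> (1 - \<gamma>\<^sub>2) * H"
        using a mult_right_mono[OF D, of h] h by (auto simp: a_def Hh mult.assoc)
      ultimately show ?thesis
        using assms L l h unfolding emeasure_lower_part[OF less_imp_le[OF L] less_imp_le[OF \<open>\<gamma>\<^sub>2 < 1\<close>]]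
          emeasure_lower_part[OF less_imp_le[OF l] less_imp_le[OF \<open>\<gamma>\<^sub>1 < 1\<close>]] h_def[symmetric] H_def[symmetric]
        by (intro ennreal_leI mult_mono[of "l ^ CARD('n)"]) auto
    qed
    have piece: "q_average q (lower_part p \<gamma>\<^sub>1 (subcube_center N x L m) (s j) l) w \<le>
        ennreal (C ^ K * c) * average (upper_part p \<gamma>\<^sub>2 x t L) w"
      if m: "m \<in> UNIV \<rightarrow>\<^sub>E {..<N}" and j: "j \<le> nat \<lfloor>2 * D / (1 - \<gamma>\<^sub>1)\<rfloor>" for m j
    proof -
      \<comment> \<open>The range of \<open>j\<close> keeps the bottom \<open>s j - h\<close> of the
        slice between \<open>t - H - h\<close> and \<open>t\<close>, where
        \<open>ex_landing_time\<close> applies.\<close>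
      have "real j \<le> real (nat \<lfloor>2 * D / (1 - \<gamma>\<^sub>1)\<rfloor>)"
        using j by simp
      also have "\<dots> \<le> 2 * D / (1 - \<gamma>\<^sub>1)"
        using D0 assms by (intro of_nat_floor) auto
      finally have "real j \<le> 2 * D / (1 - \<gamma>\<^sub>1)" .
      then have "real j * (a / 2) \<le> 2 * D / (1 - \<gamma>\<^sub>1) * (a / 2)"
        using a by (intro mult_right_mono) auto
      also have "\<dots> = H"
        using assms by (simp add: Hh a_def)
      finally have ja: "real j * (a / 2) \<le> H" .
      have "0 \<le> real j * (a / 2)"
        using a by simp
      then have sj: "t - H - h \<le> s j - h" "s j - h \<le> t"
        using ja a unfolding s_def left_diff_distrib by linarith+
      have "2 * h \<le> (1 - \<gamma>\<^sub>2) * H"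
        using mult_right_mono[OF D, of h] h by (simp add: Hh mult.assoc)
      then obtain k where k: "k \<le> nat \<lfloor>2 * (H / h) + 1\<rfloor>"
          "t + \<gamma>\<^sub>2 * H \<le> s j - h + real (Suc k) * ((1 + \<gamma>\<^sub>1) * h)"
          "s j - h + real (Suc k) * ((1 + \<gamma>\<^sub>1) * h) + (1 - \<gamma>\<^sub>1) * h \<le> t + H"
        using ex_landing_time[OF h \<open>0 \<le> \<gamma>\<^sub>1\<close> \<open>0 \<le> \<gamma>\<^sub>2\<close> _ sj] H0 by blast
      define S where "S = lower_part p \<gamma>\<^sub>1 (subcube_center N x L m)
        (s j + real (Suc k) * ((1 + \<gamma>\<^sub>1) * h)) l"
      have "Suc k \<le> K"
        using k(1) h by (simp add: K_def Hh)
      then have CK: "ennreal C ^ Suc k \<le> ennreal (C ^ K)"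
        using C1 power_increasing[of "Suc k" K C] by (simp add: ennreal_power ennreal_leI del: power_Suc)
      have "S \<subseteq> upper_part p \<gamma>\<^sub>2 x t L"
      proof -
        have "{s j + real (Suc k) * ((1 + \<gamma>\<^sub>1) * h) - h <..< s j + real (Suc k) * ((1 + \<gamma>\<^sub>1) * h) - \<gamma>\<^sub>1 * h}
            \<subseteq> {t + \<gamma>\<^sub>2 * H <..< t + H}"
          using k(2,3) by (intro greaterThanLessThan_subseteq_greaterThanLessThan[THEN iffD2]) (auto simp: algebra_simps)
        then show ?thesis
          using subcube_subset[OF L m, of x] unfolding S_def lower_part_def upper_part_def
          by (auto simp flip: l_def h_def H_def)
      qed
      then have S: "average S w \<le> ennreal c * average (upper_part p \<gamma>\<^sub>2 x t L) w"
        unfolding S_def upper_part_eq_lower_part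
        using assms L l by (intro average_le_of_subset emeasure_lower_part_pos_finite sets_lower_part
            eq_refl[OF measR])
      have "q_average q (lower_part p \<gamma>\<^sub>1 (subcube_center N x L m) (s j) l) w \<le>
          ennreal C ^ Suc k * average S w"
        unfolding S_def h_def by (rule q_average_shift_iterate[OF w \<open>1 < q\<close> l \<open>\<gamma>\<^sub>1 < 1\<close> C[OF l]])
      also have "\<dots> \<le> ennreal (C ^ K) * (ennreal c * average (upper_part p \<gamma>\<^sub>2 x t L) w)"
        using CK S by (rule mult_mono) simp_all
      also have "\<dots> = ennreal (C ^ K * c) * average (upper_part p \<gamma>\<^sub>2 x t L) w"
        using C1 c by (simp add: ennreal_mult mult.assoc)
      finally show ?thesis .
    qed
    have "q_average q (lower_part p \<gamma>\<^sub>2 x t L) w \<le>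
        of_nat (card I) * (ennreal (C ^ K * c) * average (upper_part p \<gamma>\<^sub>2 x t L) w)"
    proof (rule q_average_le_of_cover[where S = "\<lambda>(m, j). lower_part p \<gamma>\<^sub>1 (subcube_center N x L m) (s j) l"])
      show "finite I"
        by (simp add: I_def finite_PiE)
      show "lower_part p \<gamma>\<^sub>2 x t L \<subseteq>
          (\<Union>i\<in>I. case i of (m, j) \<Rightarrow> lower_part p \<gamma>\<^sub>1 (subcube_center N x L m) (s j) l)"
        using lower_part_subset_slices[OF N0 L \<open>\<gamma>\<^sub>1 < 1\<close> \<open>0 \<le> \<gamma>\<^sub>2\<close>, of p x t]
        by (simp add: I_def s_def a_def h_def l_def H_def D_def)
      show "w \<in> borel_measurable lebesgue"
        using w by (rule weight_measurable)
    qed (use assms L l measS piece in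
        \<open>auto simp: I_def simp del: emeasure_completion
          intro: emeasure_lower_part_pos_finite emeasure_lower_part_pos_finite(2)[unfolded infinity_ennreal_def]\<close>)
    then show ?thesis
      using C1 c by (simp add: ennreal_mult ennreal_of_nat_eq_real_of_nat mult.assoc)
  qed
  moreover have "0 \<le> real (card I) * (C ^ K * c)"
    using C1 c by simp
  ultimately show ?thesis
    unfolding reverse_holder_gap_def by blast
qed

theorem lemma2p5:
  fixes w :: "(real ^ 'n) \<times> real \<Rightarrow> real" and p \<gamma> :: real and q :: ennreal
  assumes "1 < p" and "1 < q" and "0 < \<gamma>" and "\<gamma> < 1" and "weight w"
  shows "w \<in> RH_plus p q \<longleftrightarrow>
    (\<exists>C::real. 0 \<le> C \<and> (\<forall>x t L. 0 < L \<longrightarrow>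
       q_average q (lower_part p \<gamma> x t L) w \<le> ennreal C * average (upper_part p \<gamma> x t L) w))"
proof -
  have "w \<in> RH_plus p q \<longleftrightarrow> reverse_holder_gap p q 0 w"
    unfolding RH_plus_def reverse_holder_gap_def mem_Collect_eq ..
  also have "\<dots> \<longleftrightarrow> reverse_holder_gap p q \<gamma> w"
  proof
    assume "reverse_holder_gap p q 0 w"
    with assms show "reverse_holder_gap p q \<gamma> w"
      by - (rule reverse_holder_gap_change[where \<gamma>\<^sub>1 = 0]; simp)
  next
    assume "reverse_holder_gap p q \<gamma> w"
    with assms show "reverse_holder_gap p q 0 w"
      by - (rule reverse_holder_gap_change[where \<gamma>\<^sub>1 = \<gamma>]; simp)
  qed
  finally show ?thesis
    unfolding reverse_holder_gap_def .
qed

end
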